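(* Let $L$ be a complete multiplicative lattice and let $\sqrt{L}$ be the ordered set of all radical elements of $L$ (a complete lattice under the order induced from $L$). Then $\mathrm{Spec}(L)$ is a spectral space if and only if the following conditions hold: (a) $\sqrt{L}$ is compact; (b) $\sqrt{L}$ is algebraic; (c) if $x$ and $y$ are compact elements in $\sqrt{L}$, then so is $x\wedge y$.
   Context: A complete multiplicative lattice is a complete lattice $L$ (smallest element $0$, largest element $1$) equipped with a binary multiplication satisfying $xy\leqslant x\wedge y$ for all $x,y\in L$; nothing else is assumed about the multiplication. An element $p\neq 1$ of $L$ is prime if for all $x,y\in L$, $xy\leqslant p$ implies $x\leqslant p$ or $y\leqslant p$. $\mathrm{Spec}(L)$ is the set of all prime elements of $L$, with the Zariski topology, whose closed sets are exactly the sets $\mathrm{V}(x)=\{p\in\mathrm{Spec}(L)\mid x\leqslant p\}$, $x\in L$. An element of $L$ is radical if it is a meet of a (possibly empty) set of prime elements. An element $x$ of a complete lattice is compact if every subset $S$ with $x\leqslant\bigvee S$ has a finite subset $F$ with $x\leqslant\bigvee F$; the lattice is compact if its largest element is compact; it is algebraic if every element is a join of compact elements. (Compactness in $\sqrt{L}$ refers to joins computed in $\sqrt{L}$.) A spectral space is a compact sober topological space in which the compact open subsets form a basis of the topology that is closed under finite intersections; sober means $\mathrm{T}_0$ and every irreducible closed subset is the closure of a one-element set. *)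

theory Defs
  imports "HOL-Analysis.T1_Spaces" "HOL-Algebra.Complete_Lattice"
begin

section \<open>Complete multiplicative lattices\<close>

record 'a multiplicative_lattice = "'a gorder" +
  lmult :: "'a \<Rightarrow> 'a \<Rightarrow> 'a" (infixl \<open>\<cdot>\<index>\<close> 70)

text \<open>The multiplication need not be associative, commutative, unital or monotone.\<close>

locale complete_multiplicative_lattice = complete_lattice L
  for L :: "('a, 'b) multiplicative_lattice_scheme" (structure) +
  assumes mult_closed: "x \<in> carrier L \<Longrightarrow> y \<in> carrier L \<Longrightarrow> x \<cdot> y \<in> carrier L"
    and mult_le_meet: "x \<in> carrier L \<Longrightarrow> y \<in> carrier L \<Longrightarrow> x \<cdot> y \<sqsubseteq> x \<sqinter> y"

definition prime_element :: "('a, 'b) multiplicative_lattice_scheme \<Rightarrow> 'a \<Rightarrow> bool" where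
  "prime_element L p \<longleftrightarrow>
     p \<in> carrier L \<and> p \<noteq> \<top>\<^bsub>L\<^esub> \<and>
     (\<forall>x\<in>carrier L. \<forall>y\<in>carrier L. x \<cdot>\<^bsub>L\<^esub> y \<sqsubseteq>\<^bsub>L\<^esub> p \<longrightarrow> x \<sqsubseteq>\<^bsub>L\<^esub> p \<or> y \<sqsubseteq>\<^bsub>L\<^esub> p)"

definition Spec :: "('a, 'b) multiplicative_lattice_scheme \<Rightarrow> 'a set" where
  "Spec L = {p. prime_element L p}"

definition V :: "('a, 'b) multiplicative_lattice_scheme \<Rightarrow> 'a \<Rightarrow> 'a set" where
  "V L x = {p \<in> Spec L. x \<sqsubseteq>\<^bsub>L\<^esub> p}"

text \<open>The lemma \<open>closedin_zariski_topology\<close> below confirms that the closed sets of this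
  topology are exactly the sets \<open>V L x\<close>.\<close>

definition zariski_topology :: "('a, 'b) multiplicative_lattice_scheme \<Rightarrow> 'a topology" where
  "zariski_topology L = topology (\<lambda>U. \<exists>x\<in>carrier L. U = Spec L - V L x)"

text \<open>The case \<open>S = {}\<close> makes the largest element radical.\<close>

definition radical_element :: "('a, 'b) multiplicative_lattice_scheme \<Rightarrow> 'a \<Rightarrow> bool" where
  "radical_element L x \<longleftrightarrow> (\<exists>S\<subseteq>Spec L. x = \<Sqinter>\<^bsub>L\<^esub>S)"

text \<open>The ordered set of radical elements: a structure with its own joins, which in general
  differ from those of \<open>L\<close>.\<close>

definition radical_lattice :: "('a, 'b) multiplicative_lattice_scheme \<Rightarrow> 'a gorder" where
  "radical_lattice L = \<lparr>carrier = {x. radical_element L x}, eq = (=), le = le L\<rparr>"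


section \<open>Compact elements and algebraic lattices\<close>

definition compact_element :: "('a, 'b) gorder_scheme \<Rightarrow> 'a \<Rightarrow> bool" where
  "compact_element L x \<longleftrightarrow>
     x \<in> carrier L \<and>
     (\<forall>S\<subseteq>carrier L. x \<sqsubseteq>\<^bsub>L\<^esub> \<Squnion>\<^bsub>L\<^esub>S \<longrightarrow> (\<exists>F\<subseteq>S. finite F \<and> x \<sqsubseteq>\<^bsub>L\<^esub> \<Squnion>\<^bsub>L\<^esub>F))"

definition compact_lattice :: "('a, 'b) gorder_scheme \<Rightarrow> bool" where
  "compact_lattice L \<longleftrightarrow> compact_element L \<top>\<^bsub>L\<^esub>"

definition algebraic_lattice :: "('a, 'b) gorder_scheme \<Rightarrow> bool" where
  "algebraic_lattice L \<longleftrightarrow>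
     (\<forall>x\<in>carrier L. \<exists>S\<subseteq>{c. compact_element L c}. x = \<Squnion>\<^bsub>L\<^esub>S)"


section \<open>Spectral spaces\<close>

definition T0_space :: "'a topology \<Rightarrow> bool" where
  "T0_space X \<longleftrightarrow>
     (\<forall>x\<in>topspace X. \<forall>y\<in>topspace X. x \<noteq> y \<longrightarrow>
        (\<exists>U. openin X U \<and> (x \<in> U \<longleftrightarrow> y \<notin> U)))"

text \<open>Irreducible sets are nonempty by convention: otherwise no space would be sober, as the
  empty set is not the closure of a point.\<close>

definition irreducible_closedin :: "'a topology \<Rightarrow> 'a set \<Rightarrow> bool" where
  "irreducible_closedin X C \<longleftrightarrow>
     closedin X C \<and> C \<noteq> {} \<and>
     (\<forall>A B. closedin X A \<longrightarrow> closedin X B \<longrightarrow> C = A \<union> B \<longrightarrow> C = A \<or> C = B)"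

definition sober_space :: "'a topology \<Rightarrow> bool" where
  "sober_space X \<longleftrightarrow>
     T0_space X \<and>
     (\<forall>C. irreducible_closedin X C \<longrightarrow> (\<exists>x\<in>topspace X. C = X closure_of {x}))"

definition compact_openin :: "'a topology \<Rightarrow> 'a set \<Rightarrow> bool" where
  "compact_openin X U \<longleftrightarrow> compactin X U \<and> openin X U"

text \<open>The intersection of the empty family is the whole space.\<close>

definition spectral_space :: "'a topology \<Rightarrow> bool" where
  "spectral_space X \<longleftrightarrow>
     compact_space X \<and> sober_space X \<and>
     (\<forall>U. openin X U \<longrightarrow> (arbitrary union_of compact_openin X) U) \<and>
     (\<forall>\<F>. finite \<F> \<longrightarrow> (\<forall>U\<in>\<F>. compact_openin X U) \<longrightarrow> compact_openin X (topspace X \<inter> \<Inter>\<F>))"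


section \<open>Basic properties\<close>

context complete_multiplicative_lattice
begin

lemma Spec_subset: "Spec L \<subseteq> carrier L"
  by (auto simp: Spec_def prime_element_def)

lemma V_bottom: "V L \<bottom> = Spec L"
  using Spec_subset by (auto simp: V_def)

lemma V_top: "V L \<top> = {}"
  using le_antisym by (fastforce simp: V_def Spec_def prime_element_def)

lemma V_mult:
  assumes x: "x \<in> carrier L" and y: "y \<in> carrier L"
  shows "V L (x \<cdot> y) = V L x \<union> V L y"
proof -
  have "x \<cdot> y \<sqsubseteq> x" "x \<cdot> y \<sqsubseteq> y"
    using mult_le_meet[OF x y] meet_left[OF x y] meet_right[OF x y] mult_closed[OF x y] x y
    by (meson le_trans meet_closed)+
  then show ?thesis
    using x y mult_closed[OF x y] le_trans
    unfolding V_def Spec_def prime_element_def by blast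
qed

lemma V_Sup:
  assumes A: "A \<subseteq> carrier L"
  shows "V L (\<Squnion>A) = {p \<in> Spec L. \<forall>a\<in>A. p \<in> V L a}"
proof -
  have "\<Squnion>A \<sqsubseteq> p \<longleftrightarrow> (\<forall>a\<in>A. a \<sqsubseteq> p)" if "p \<in> carrier L" for p
    using A that by (meson le_trans subsetD sup_closed sup_least sup_upper)
  then show ?thesis
    using Spec_subset by (auto simp: V_def)
qed

lemma istopology_zariski: "istopology (\<lambda>U. \<exists>x\<in>carrier L. U = Spec L - V L x)"
  unfolding istopology_def
proof (intro conjI allI impI)
  fix S T
  assume "\<exists>x\<in>carrier L. S = Spec L - V L x" "\<exists>x\<in>carrier L. T = Spec L - V L x"
  then obtain x y where xy: "x \<in> carrier L" "y \<in> carrier L"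
    and "S = Spec L - V L x" "T = Spec L - V L y" by blast
  then have "S \<inter> T = Spec L - V L (x \<cdot> y)" by (auto simp: V_mult)
  then show "\<exists>x\<in>carrier L. S \<inter> T = Spec L - V L x"
    using mult_closed[OF xy] by blast
next
  fix \<K>
  assume K: "\<forall>K\<in>\<K>. \<exists>x\<in>carrier L. K = Spec L - V L x"
  define A where "A = {x \<in> carrier L. Spec L - V L x \<in> \<K>}"
  have A: "A \<subseteq> carrier L" by (auto simp: A_def)
  have "\<Union>\<K> = (\<Union>a\<in>A. Spec L - V L a)" using K by (auto simp: A_def)
  also have "\<dots> = Spec L - V L (\<Squnion>A)" by (auto simp: V_Sup[OF A])
  finally show "\<exists>x\<in>carrier L. \<Union>\<K> = Spec L - V L x"
    using sup_closed[OF A] by blast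
qed

lemma openin_zariski_topology:
  "openin (zariski_topology L) U \<longleftrightarrow> (\<exists>x\<in>carrier L. U = Spec L - V L x)"
  unfolding zariski_topology_def topology_inverse'[OF istopology_zariski] ..

lemma topspace_zariski_topology: "topspace (zariski_topology L) = Spec L"
proof
  show "topspace (zariski_topology L) \<subseteq> Spec L"
    using openin_topspace[of "zariski_topology L"] unfolding openin_zariski_topology by blast
  have "openin (zariski_topology L) (Spec L)"
    unfolding openin_zariski_topology by (rule bexI[of _ \<top>]) (auto simp: V_top)
  then show "Spec L \<subseteq> topspace (zariski_topology L)" by (rule openin_subset)
qed

lemma closedin_zariski_topology:
  "closedin (zariski_topology L) C \<longleftrightarrow> (\<exists>x\<in>carrier L. C = V L x)"
proof -
  have "V L x \<subseteq> Spec L" for x by (auto simp: V_def)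
  then show ?thesis
    unfolding closedin_def topspace_zariski_topology openin_zariski_topology by blast
qed

lemma radical_lattice_simps:
  "carrier (radical_lattice L) = {x. radical_element L x}"
  "le (radical_lattice L) = le L" "eq (radical_lattice L) = (=)"
  by (simp_all add: radical_lattice_def)

lemma radical_element_closed: "radical_element L x \<Longrightarrow> x \<in> carrier L"
  unfolding radical_element_def using inf_closed[OF subset_trans[OF _ Spec_subset]] by auto

lemma radical_element_Inf:
  assumes A: "A \<subseteq> {x. radical_element L x}"
  shows "radical_element L (\<Sqinter>A)"
proof -
  have AL: "A \<subseteq> carrier L" using A radical_element_closed by blast
  define S where "S = {p \<in> Spec L. \<exists>a\<in>A. a \<sqsubseteq> p}"
  have SL: "S \<subseteq> carrier L" using Spec_subset by (auto simp: S_def)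
  have "\<Sqinter>A = \<Sqinter>S"
  proof (rule le_antisym)
    show "\<Sqinter>A \<sqsubseteq> \<Sqinter>S"
    proof (rule inf_greatest[OF SL inf_closed[OF AL]])
      fix p assume p: "p \<in> S"
      then obtain a where a: "a \<in> A" "a \<sqsubseteq> p" by (auto simp: S_def)
      show "\<Sqinter>A \<sqsubseteq> p"
        using le_trans[OF inf_lower[OF AL a(1)] a(2)] AL SL a p inf_closed[OF AL] by blast
    qed
    show "\<Sqinter>S \<sqsubseteq> \<Sqinter>A"
    proof (rule inf_greatest[OF AL inf_closed[OF SL]])
      fix a assume a: "a \<in> A"
      then obtain T where T: "T \<subseteq> Spec L" "a = \<Sqinter>T"
        using A by (auto simp: radical_element_def)
      then have TL: "T \<subseteq> carrier L" using Spec_subset by blast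
      have "T \<subseteq> S"
      proof
        fix p assume p: "p \<in> T"
        have "a \<sqsubseteq> p" unfolding T(2) by (rule inf_lower[OF TL p])
        with a p T(1) show "p \<in> S" unfolding S_def by blast
      qed
      then show "\<Sqinter>S \<sqsubseteq> a"
        unfolding T(2) using inf_greatest[OF TL inf_closed[OF SL]] inf_lower[OF SL] by blast
    qed
  qed (use AL SL in auto)
  moreover have "S \<subseteq> Spec L" by (auto simp: S_def)
  ultimately show ?thesis unfolding radical_element_def by (intro exI[of _ S] conjI)
qed

lemma complete_lattice_radical_lattice: "complete_lattice (radical_lattice L)"
proof -
  interpret R: partial_order "radical_lattice L"
    by standard
       (auto simp: radical_lattice_simps intro: le_antisym le_trans dest: radical_element_closed)
  have inf: "greatest (radical_lattice L) (\<Sqinter>A) (Lower (radical_lattice L) A)"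
    if A: "A \<subseteq> carrier (radical_lattice L)" for A
  proof -
    have A': "A \<subseteq> {x. radical_element L x}" using A by (simp add: radical_lattice_simps)
    have AL: "A \<subseteq> carrier L" using A' radical_element_closed by blast
    show ?thesis
      unfolding greatest_def
    proof (intro conjI ballI)
      show "Lower (radical_lattice L) A \<subseteq> carrier (radical_lattice L)" by (auto simp: Lower_def)
      show "\<Sqinter>A \<in> Lower (radical_lattice L) A"
        using radical_element_Inf[OF A'] inf_lower[OF AL]
        by (auto simp: Lower_def radical_lattice_simps)
      fix x assume x: "x \<in> Lower (radical_lattice L) A"
      have "x \<in> carrier L"
        using x radical_element_closed by (auto simp: Lower_def radical_lattice_simps)
      then have "x \<sqsubseteq> \<Sqinter>A"
      proof (rule inf_greatest[OF AL])
        show "x \<sqsubseteq> a" if "a \<in> A" for a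
          using x A that by (auto simp: Lower_def radical_lattice_simps)
      qed
      then show "x \<sqsubseteq>\<^bsub>radical_lattice L\<^esub> \<Sqinter>A" by (simp add: radical_lattice_simps)
    qed
  qed
  show ?thesis
  proof (rule R.complete_lattice_criterion1)
    show "\<exists>g. greatest (radical_lattice L) g (carrier (radical_lattice L))"
      using inf[of "{}"] by (auto simp: Lower_def)
  qed (use inf in blast)
qed

end

end

theory Submission
  imports Defs
begin

text \<open>Sending a radical element to the complement of its hull is an isomorphism from the lattice
  of radical elements onto the lattice of open sets. It matches compact elements with compact open
  sets and meets with intersections, so (a), (b) and (c) say that the space is compact, that the
  compact open sets form a basis, and that they are closed under binary intersections. Sobriety
  holds for every \<open>L\<close>: the meet of an irreducible closed set is a prime element, and it
  generates the set.\<close>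

definition basic_open :: "('a, 'b) multiplicative_lattice_scheme \<Rightarrow> 'a \<Rightarrow> 'a set" where
  "basic_open L x = Spec L - V L x"

context complete_multiplicative_lattice
begin

section \<open>Hulls and radical elements\<close>

lemma V_antimono:
  assumes "x \<in> carrier L" "y \<in> carrier L" "x \<sqsubseteq> y"
  shows "V L y \<subseteq> V L x"
proof
  fix p assume "p \<in> V L y"
  then have p: "p \<in> Spec L" "y \<sqsubseteq> p" by (simp_all add: V_def)
  then have "x \<sqsubseteq> p" using assms Spec_subset le_trans[OF assms(3) p(2)] by blast
  with p(1) show "p \<in> V L x" by (simp add: V_def)
qed

lemma Inf_V_closed: "\<Sqinter>(V L x) \<in> carrier L"
  using Spec_subset by (intro inf_closed) (auto simp: V_def)

lemma radical_element_Inf_V: "radical_element L (\<Sqinter>(V L x))"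
  unfolding radical_element_def by (rule exI[of _ "V L x"]) (auto simp: V_def)

text \<open>The meet of the hull lies above \<open>x\<close> and below every prime of the hull, so
  passing to it neither adds nor loses primes. Thus \<open>\<Sqinter>(V L x)\<close> is the radical
  of \<open>x\<close>, and every closed set is the hull of a radical element.\<close>

lemma V_Inf_V:
  assumes x: "x \<in> carrier L"
  shows "V L (\<Sqinter>(V L x)) = V L x"
proof
  have VL: "V L x \<subseteq> carrier L" using Spec_subset by (auto simp: V_def)
  have "x \<sqsubseteq> \<Sqinter>(V L x)" by (rule inf_greatest[OF VL x]) (simp add: V_def)
  then show "V L (\<Sqinter>(V L x)) \<subseteq> V L x"
    by (rule V_antimono[OF x Inf_V_closed])
  show "V L x \<subseteq> V L (\<Sqinter>(V L x))"
  proof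
    fix p assume p: "p \<in> V L x"
    then show "p \<in> V L (\<Sqinter>(V L x))" using inf_lower[OF VL p] by (simp add: V_def)
  qed
qed

text \<open>A radical \<open>r\<close> is a meet of primes that all belong to its hull, so inclusion
  of hulls puts \<open>x\<close> below each of them and hence below \<open>r\<close>. Only
  \<open>r\<close> has to be radical; the sobriety proof takes a product for
  \<open>x\<close>.\<close>

lemma le_radical_iff:
  assumes x: "x \<in> carrier L" and r: "radical_element L r"
  shows "x \<sqsubseteq> r \<longleftrightarrow> V L r \<subseteq> V L x"
proof
  assume "x \<sqsubseteq> r"
  then show "V L r \<subseteq> V L x"
    by (rule V_antimono[OF x radical_element_closed[OF r]])
next
  assume sub: "V L r \<subseteq> V L x"
  obtain S where S: "S \<subseteq> Spec L" "r = \<Sqinter>S" using r by (auto simp: radical_element_def)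
  then have SL: "S \<subseteq> carrier L" using Spec_subset by blast
  show "x \<sqsubseteq> r"
    unfolding S(2)
  proof (rule inf_greatest[OF SL x])
    fix p assume p: "p \<in> S"
    have "r \<sqsubseteq> p" unfolding S(2) by (rule inf_lower[OF SL p])
    with p S(1) sub show "x \<sqsubseteq> p" by (auto simp: V_def)
  qed
qed

lemma radical_element_prime: "p \<in> Spec L \<Longrightarrow> radical_element L p"
  unfolding radical_element_def
  using Spec_subset by (intro exI[of _ "{p}"]) (auto intro!: le_antisym inf_greatest inf_lower)

text \<open>No monotonicity of the multiplication enters: the hull of the meet is squeezed between
  \<open>V L x \<union> V L y\<close> and the hull of the smaller element
  \<open>x \<cdot> y\<close>, and these two sets agree by primeness.\<close>

lemma V_meet:
  assumes x: "x \<in> carrier L" and y: "y \<in> carrier L"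
  shows "V L (x \<sqinter> y) = V L x \<union> V L y"
proof
  have "V L (x \<sqinter> y) \<subseteq> V L (x \<cdot> y)"
    by (rule V_antimono[OF mult_closed[OF x y] meet_closed[OF x y] mult_le_meet[OF x y]])
  then show "V L (x \<sqinter> y) \<subseteq> V L x \<union> V L y" by (simp add: V_mult[OF x y])
  show "V L x \<union> V L y \<subseteq> V L (x \<sqinter> y)"
    using V_antimono[OF meet_closed[OF x y] x meet_left[OF x y]]
      V_antimono[OF meet_closed[OF x y] y meet_right[OF x y]] by blast
qed

section \<open>Closures of points and sobriety\<close>

lemma closure_of_prime:
  assumes p: "p \<in> Spec L"
  shows "zariski_topology L closure_of {p} = V L p"
proof (rule closure_of_unique)
  show "closedin (zariski_topology L) (V L p)"
    using p Spec_subset by (auto simp: closedin_zariski_topology)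
  show "{p} \<subseteq> V L p" using p Spec_subset by (auto simp: V_def)
  fix T assume "{p} \<subseteq> T" "closedin (zariski_topology L) T"
  then obtain x where "x \<in> carrier L" "T = V L x" "p \<in> V L x"
    by (auto simp: closedin_zariski_topology)
  then show "V L p \<subseteq> T"
    using p Spec_subset V_antimono[of x p] unfolding V_def[of L x] by blast
qed

lemma sober_zariski_topology: "sober_space (zariski_topology L)"
  unfolding sober_space_def T0_space_def
proof (intro conjI ballI allI impI)
  fix p q
  assume "p \<in> topspace (zariski_topology L)" "q \<in> topspace (zariski_topology L)"
  then have pq: "p \<in> Spec L" "q \<in> Spec L" by (simp_all add: topspace_zariski_topology)
  then have L: "p \<in> carrier L" "q \<in> carrier L" using Spec_subset by auto
  assume "p \<noteq> q"
  then have "\<not> p \<sqsubseteq> q \<or> \<not> q \<sqsubseteq> p" using L le_antisym by blast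
  \<comment> \<open>If \<open>p\<close> is not below \<open>q\<close>, then the complement of
    \<open>V L p\<close> contains \<open>q\<close> but not \<open>p\<close>; the other case is
    symmetric.\<close>
  then have "(p \<in> Spec L - V L p \<longleftrightarrow> q \<notin> Spec L - V L p) \<or>
      (p \<in> Spec L - V L q \<longleftrightarrow> q \<notin> Spec L - V L q)"
    using pq L by (auto simp: V_def)
  then show "\<exists>U. openin (zariski_topology L) U \<and> (p \<in> U \<longleftrightarrow> q \<notin> U)"
    using L unfolding openin_zariski_topology by blast
next
  fix C assume C: "irreducible_closedin (zariski_topology L) C"
  then obtain x where x: "x \<in> carrier L" "C = V L x"
    by (auto simp: irreducible_closedin_def closedin_zariski_topology)
  have CL: "C \<subseteq> Spec L" "C \<subseteq> carrier L" using x(2) Spec_subset by (auto simp: V_def)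
  \<comment> \<open>Irreducibility is defined through decompositions equal to \<open>C\<close>.
    Intersecting the two covering hulls with \<open>C\<close> turns a cover into such a
    decomposition.\<close>
  have irred: "C \<subseteq> V L a \<or> C \<subseteq> V L b"
    if a: "a \<in> carrier L" and b: "b \<in> carrier L" and sub: "C \<subseteq> V L a \<union> V L b" for a b
  proof -
    have "closedin (zariski_topology L) (V L a)" "closedin (zariski_topology L) (V L b)"
      using a b closedin_zariski_topology by blast+
    then have "closedin (zariski_topology L) (C \<inter> V L a)" "closedin (zariski_topology L) (C \<inter> V L b)"
      using C by (simp_all add: irreducible_closedin_def closedin_Int)
    moreover have "C = (C \<inter> V L a) \<union> (C \<inter> V L b)" using sub by blast
    ultimately have "C = C \<inter> V L a \<or> C = C \<inter> V L b"
      using C unfolding irreducible_closedin_def by blast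
    then show ?thesis by blast
  qed
  \<comment> \<open>The candidate generic point. Since \<open>C\<close> is a hull, its meet is
    radical and has hull exactly \<open>C\<close>, so comparisons with \<open>p\<close> become
    inclusions of \<open>C\<close> in hulls.\<close>
  define p where "p = \<Sqinter>C"
  have pL: "p \<in> carrier L" unfolding p_def by (rule inf_closed[OF CL(2)])
  have p_rad: "radical_element L p" and Vp: "V L p = C"
    unfolding p_def x(2) using radical_element_Inf_V V_Inf_V[OF x(1)] by auto
  have "p \<in> Spec L"
    unfolding Spec_def prime_element_def
  proof (intro CollectI conjI ballI impI pL)
    \<comment> \<open>This is where \<open>C\<close> being nonempty enters: the hull of
      \<open>\<top>\<close> is empty.\<close>
    show "p \<noteq> \<top>" using C Vp V_top by (auto simp: irreducible_closedin_def)
    fix a b assume ab: "a \<in> carrier L" "b \<in> carrier L" "a \<cdot> b \<sqsubseteq> p"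
    \<comment> \<open>The hull of a product is a union of two hulls, so irreducibility of
      \<open>C\<close> is exactly primeness of \<open>p\<close>.\<close>
    then have "C \<subseteq> V L a \<union> V L b"
      using le_radical_iff[OF mult_closed[OF ab(1,2)] p_rad] Vp V_mult by simp
    then show "a \<sqsubseteq> p \<or> b \<sqsubseteq> p"
      using irred ab(1,2) le_radical_iff p_rad Vp by simp
  qed
  then show "\<exists>p\<in>topspace (zariski_topology L). C = (zariski_topology L) closure_of {p}"
    using closure_of_prime Vp by (auto simp: topspace_zariski_topology)
qed

section \<open>The isomorphism between radical elements and open sets\<close>

lemma openin_zariski_iff_radical:
  "openin (zariski_topology L) U \<longleftrightarrow> (\<exists>r. radical_element L r \<and> U = basic_open L r)"
  unfolding openin_zariski_topology basic_open_def
proof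
  assume "\<exists>x\<in>carrier L. U = Spec L - V L x"
  then obtain x where "x \<in> carrier L" "U = Spec L - V L x" by blast
  \<comment> \<open>The radical of \<open>x\<close> has the same hull as \<open>x\<close>, hence
    defines the same open set.\<close>
  then show "\<exists>r. radical_element L r \<and> U = Spec L - V L r"
    using V_Inf_V radical_element_Inf_V by (intro exI[of _ "\<Sqinter>(V L x)"]) simp
qed (use radical_element_closed in blast)

lemma basic_open_subset_iff:
  assumes "radical_element L r" "radical_element L s"
  shows "basic_open L r \<subseteq> basic_open L s \<longleftrightarrow> r \<sqsubseteq> s"
  using le_radical_iff[OF radical_element_closed[OF assms(1)] assms(2)]
  by (auto simp: basic_open_def V_def)

lemma basic_open_inject:
  assumes "radical_element L r" "radical_element L s" "basic_open L r = basic_open L s"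
  shows "r = s"
proof (rule le_antisym)
  show "r \<sqsubseteq> s" using basic_open_subset_iff[OF assms(1,2)] assms(3) by simp
  show "s \<sqsubseteq> r" using basic_open_subset_iff[OF assms(2,1)] assms(3) by simp
qed (use assms radical_element_closed in auto)

text \<open>The join is the one of the radical lattice, which may exceed the join in
  \<open>L\<close>. It still has the right hull: a prime above all members of \<open>A\<close> is
  itself radical, so it is an upper bound within the radical lattice and lies above the
  join.\<close>

lemma basic_open_radical_Sup:
  assumes A: "A \<subseteq> {x. radical_element L x}"
  shows "basic_open L (\<Squnion>\<^bsub>radical_lattice L\<^esub>A) = \<Union>(basic_open L ` A)"
proof -
  interpret R: complete_lattice "radical_lattice L" by (rule complete_lattice_radical_lattice)
  have AR: "A \<subseteq> carrier (radical_lattice L)" using A by (simp add: radical_lattice_simps)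
  have sup: "radical_element L (\<Squnion>\<^bsub>radical_lattice L\<^esub>A)"
    using R.sup_closed[OF AR] by (simp add: radical_lattice_simps)
  have "V L (\<Squnion>\<^bsub>radical_lattice L\<^esub>A) \<subseteq> V L a" if a: "a \<in> A" for a
    using R.sup_upper[OF AR a] a A sup radical_element_closed
    by (intro V_antimono) (auto simp: radical_lattice_simps)
  moreover have "p \<in> V L (\<Squnion>\<^bsub>radical_lattice L\<^esub>A)"
    if p: "p \<in> Spec L" and "\<forall>a\<in>A. p \<in> V L a" for p
    using R.sup_least[OF AR, of p] radical_element_prime[OF p] that
    by (simp add: radical_lattice_simps V_def)
  ultimately show ?thesis unfolding basic_open_def by blast
qed

text \<open>Unlike joins, meets agree with those of \<open>L\<close>, because radical elements are
  closed under meets taken in \<open>L\<close>. This makes \<open>V_meet\<close> applicable to meets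
  of the radical lattice.\<close>

lemma radical_meet:
  assumes r: "radical_element L r" and s: "radical_element L s"
  shows "radical_element L (r \<sqinter>\<^bsub>radical_lattice L\<^esub> s)" "r \<sqinter>\<^bsub>radical_lattice L\<^esub> s = r \<sqinter> s"
proof -
  interpret R: complete_lattice "radical_lattice L" by (rule complete_lattice_radical_lattice)
  have rs: "r \<in> carrier (radical_lattice L)" "s \<in> carrier (radical_lattice L)"
    using r s by (simp_all add: radical_lattice_simps)
  have rsL: "r \<in> carrier L" "s \<in> carrier L" using r s radical_element_closed by auto
  show rad: "radical_element L (r \<sqinter>\<^bsub>radical_lattice L\<^esub> s)"
    using R.meet_closed[OF rs] by (simp add: radical_lattice_simps)
  have radL: "radical_element L (r \<sqinter> s)"
    unfolding meet_def using r s by (intro radical_element_Inf) auto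
  show "r \<sqinter>\<^bsub>radical_lattice L\<^esub> s = r \<sqinter> s"
  proof (rule le_antisym)
    show "r \<sqinter>\<^bsub>radical_lattice L\<^esub> s \<sqsubseteq> r \<sqinter> s"
      using R.meet_left[OF rs] R.meet_right[OF rs] rsL radical_element_closed[OF rad]
      by (intro meet_le) (simp_all add: radical_lattice_simps)
    show "r \<sqinter> s \<sqsubseteq> r \<sqinter>\<^bsub>radical_lattice L\<^esub> s"
      using R.meet_le[OF _ _ rs, of "r \<sqinter> s"] meet_left[OF rsL] meet_right[OF rsL] radL rs
      by (simp add: radical_lattice_simps)
  qed (use rad radL radical_element_closed in auto)
qed

lemma basic_open_radical_meet:
  assumes "radical_element L r" "radical_element L s"
  shows "basic_open L (r \<sqinter>\<^bsub>radical_lattice L\<^esub> s) = basic_open L r \<inter> basic_open L s"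
  using radical_meet(2)[OF assms] V_meet assms radical_element_closed
  by (auto simp: basic_open_def)

lemma radical_top: "\<top>\<^bsub>radical_lattice L\<^esub> = \<top>"
proof -
  interpret R: complete_lattice "radical_lattice L" by (rule complete_lattice_radical_lattice)
  \<comment> \<open>The hull of \<open>\<top>\<close> is empty, so this is the empty meet; it
    exhibits \<open>\<top>\<close> as radical.\<close>
  have "\<Sqinter>(V L \<top>) = \<top>"
    using top_higher[OF inf_closed[of "{}"]] inf_greatest[of "{}" \<top>] inf_closed[of "{}"]
    by (intro le_antisym) (simp_all add: V_top)
  then have top: "radical_element L \<top>" using radical_element_Inf_V by metis
  then have "\<top> \<sqsubseteq> \<top>\<^bsub>radical_lattice L\<^esub>"
    using R.top_higher[of \<top>] by (simp add: radical_lattice_simps)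
  then show ?thesis
    using R.top_closed radical_element_closed by (intro le_antisym) (auto simp: radical_lattice_simps)
qed

lemma basic_open_radical_top: "basic_open L \<top>\<^bsub>radical_lattice L\<^esub> = topspace (zariski_topology L)"
  by (simp add: radical_top basic_open_def V_top topspace_zariski_topology)

section \<open>Translation of the three lattice conditions\<close>

lemma compact_element_radical_iff:
  assumes r: "radical_element L r"
  shows "compact_element (radical_lattice L) r \<longleftrightarrow> compact_openin (zariski_topology L) (basic_open L r)"
proof -
  interpret R: complete_lattice "radical_lattice L" by (rule complete_lattice_radical_lattice)
  \<comment> \<open>The dictionary for compactness: lying below a join means being covered by the
    corresponding open sets. Finite subsets with a large enough join then correspond to finite
    subcovers.\<close>
  have le_Sup: "r \<sqsubseteq>\<^bsub>radical_lattice L\<^esub> \<Squnion>\<^bsub>radical_lattice L\<^esub>A \<longleftrightarrow> basic_open L r \<subseteq> \<Union>(basic_open L ` A)"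
    if "A \<subseteq> carrier (radical_lattice L)" for A
    using that R.sup_closed[OF that] basic_open_subset_iff[OF r, of "\<Squnion>\<^bsub>radical_lattice L\<^esub>A"]
      basic_open_radical_Sup[of A]
    by (simp add: radical_lattice_simps)
  have "openin (zariski_topology L) (basic_open L r)"
    using r openin_zariski_iff_radical by blast
  moreover have "compact_element (radical_lattice L) r"
    if comp: "compactin (zariski_topology L) (basic_open L r)"
    unfolding compact_element_def
  proof (intro conjI allI impI)
    show "r \<in> carrier (radical_lattice L)" using r by (simp add: radical_lattice_simps)
    fix S assume S: "S \<subseteq> carrier (radical_lattice L)"
      and "r \<sqsubseteq>\<^bsub>radical_lattice L\<^esub> \<Squnion>\<^bsub>radical_lattice L\<^esub>S"
    then have "basic_open L r \<subseteq> \<Union>(basic_open L ` S)" by (simp add: le_Sup)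
    moreover have "openin (zariski_topology L) U" if "U \<in> basic_open L ` S" for U
      using that S openin_zariski_iff_radical by (auto simp: radical_lattice_simps)
    ultimately obtain \<F> where \<F>: "finite \<F>" "\<F> \<subseteq> basic_open L ` S" "basic_open L r \<subseteq> \<Union>\<F>"
      using comp compactinD by metis
    \<comment> \<open>A finite subcover consists of images of members of \<open>S\<close>; choosing
      one preimage for each set yields a finite subset of \<open>S\<close>.\<close>
    then obtain F where F: "F \<subseteq> S" "finite F" "\<F> = basic_open L ` F"
      by (meson finite_subset_image)
    have "F \<subseteq> carrier (radical_lattice L)" by (rule subset_trans[OF F(1) S])
    then have "r \<sqsubseteq>\<^bsub>radical_lattice L\<^esub> \<Squnion>\<^bsub>radical_lattice L\<^esub>F" using F(3) \<F>(3) le_Sup by simp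
    then show "\<exists>F\<subseteq>S. finite F \<and> r \<sqsubseteq>\<^bsub>radical_lattice L\<^esub> \<Squnion>\<^bsub>radical_lattice L\<^esub>F"
      using F(1,2) by (intro exI[of _ F] conjI)
  qed
  moreover have "compactin (zariski_topology L) (basic_open L r)"
    if comp: "compact_element (radical_lattice L) r"
    unfolding compactin_def
  proof (intro conjI allI impI)
    show "basic_open L r \<subseteq> topspace (zariski_topology L)"
      by (auto simp: basic_open_def topspace_zariski_topology)
    fix \<U> assume \<U>: "Ball \<U> (openin (zariski_topology L)) \<and> basic_open L r \<subseteq> \<Union>\<U>"
    \<comment> \<open>All radical elements representing a member of the cover. As every open set is
      represented, the sets indexed by \<open>A\<close> still cover.\<close>
    define A where "A = {a. radical_element L a \<and> basic_open L a \<in> \<U>}"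
    have A: "A \<subseteq> carrier (radical_lattice L)" by (auto simp: A_def radical_lattice_simps)
    have "\<U> \<subseteq> basic_open L ` A"
    proof
      fix U assume U: "U \<in> \<U>"
      then obtain a where "radical_element L a" "U = basic_open L a"
        using \<U> openin_zariski_iff_radical by auto
      then show "U \<in> basic_open L ` A" using U by (auto simp: A_def)
    qed
    then have "basic_open L r \<subseteq> \<Union>(basic_open L ` A)" using \<U> by blast
    then have "r \<sqsubseteq>\<^bsub>radical_lattice L\<^esub> \<Squnion>\<^bsub>radical_lattice L\<^esub>A" by (simp only: le_Sup[OF A])
    then obtain F where F: "F \<subseteq> A" "finite F" "r \<sqsubseteq>\<^bsub>radical_lattice L\<^esub> \<Squnion>\<^bsub>radical_lattice L\<^esub>F"
      using comp A unfolding compact_element_def by meson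
    have "basic_open L r \<subseteq> \<Union>(basic_open L ` F)"
      using F(3) by (simp only: le_Sup[OF subset_trans[OF F(1) A]])
    then show "\<exists>\<F>. finite \<F> \<and> \<F> \<subseteq> \<U> \<and> basic_open L r \<subseteq> \<Union>\<F>"
      using F(1,2) unfolding A_def by (intro exI[of _ "basic_open L ` F"]) auto
  qed
  ultimately show ?thesis unfolding compact_openin_def by blast
qed

lemma compact_element_radicalD: "compact_element (radical_lattice L) r \<Longrightarrow> radical_element L r"
  by (simp add: compact_element_def radical_lattice_simps)

lemma compact_openin_zariski_iff:
  "compact_openin (zariski_topology L) U \<longleftrightarrow>
     (\<exists>r. compact_element (radical_lattice L) r \<and> U = basic_open L r)"
proof
  assume U: "compact_openin (zariski_topology L) U"
  then obtain r where "radical_element L r" "U = basic_open L r"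
    by (auto simp: compact_openin_def openin_zariski_iff_radical)
  then show "\<exists>r. compact_element (radical_lattice L) r \<and> U = basic_open L r"
    using U compact_element_radical_iff by blast
qed (use compact_element_radical_iff compact_element_radicalD in blast)

lemma compact_radical_lattice_iff:
  "compact_lattice (radical_lattice L) \<longleftrightarrow> compact_space (zariski_topology L)"
proof -
  interpret R: complete_lattice "radical_lattice L" by (rule complete_lattice_radical_lattice)
  have "radical_element L \<top>\<^bsub>radical_lattice L\<^esub>"
    using R.top_closed by (simp add: radical_lattice_simps)
  then show ?thesis
    by (simp add: compact_lattice_def compact_element_radical_iff basic_open_radical_top
        compact_openin_def compact_space_def)
qed

text \<open>Joins of compact elements become unions of compact open sets. Since every open set comes
  from a radical element, it suffices to compare the two conditions one radical element at a
  time.\<close>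

lemma algebraic_radical_lattice_iff:
  "algebraic_lattice (radical_lattice L) \<longleftrightarrow>
     (\<forall>U. openin (zariski_topology L) U \<longrightarrow>
        (arbitrary union_of compact_openin (zariski_topology L)) U)"
proof -
  interpret R: complete_lattice "radical_lattice L" by (rule complete_lattice_radical_lattice)
  have "(\<exists>S\<subseteq>{c. compact_element (radical_lattice L) c}. r = \<Squnion>\<^bsub>radical_lattice L\<^esub>S) \<longleftrightarrow>
      (arbitrary union_of compact_openin (zariski_topology L)) (basic_open L r)"
    if r: "radical_element L r" for r
  proof
    assume "\<exists>S\<subseteq>{c. compact_element (radical_lattice L) c}. r = \<Squnion>\<^bsub>radical_lattice L\<^esub>S"
    then obtain S where S: "S \<subseteq> {c. compact_element (radical_lattice L) c}"
      "r = \<Squnion>\<^bsub>radical_lattice L\<^esub>S" by blast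
    then have "S \<subseteq> {x. radical_element L x}" using compact_element_radicalD by blast
    then have "basic_open L r = \<Union>(basic_open L ` S)"
      unfolding S(2) by (rule basic_open_radical_Sup)
    moreover have "basic_open L ` S \<subseteq> Collect (compact_openin (zariski_topology L))"
      using S(1) by (force simp: compact_openin_zariski_iff)
    ultimately show "(arbitrary union_of compact_openin (zariski_topology L)) (basic_open L r)"
      unfolding union_of_def arbitrary_def by (intro exI[of _ "basic_open L ` S"]) simp
  next
    assume "(arbitrary union_of compact_openin (zariski_topology L)) (basic_open L r)"
    then obtain \<U> where \<U>: "\<U> \<subseteq> Collect (compact_openin (zariski_topology L))"
      "\<Union>\<U> = basic_open L r" by (auto simp: union_of_def)
    define S where "S = {c. compact_element (radical_lattice L) c \<and> basic_open L c \<in> \<U>}"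
    have S: "S \<subseteq> {x. radical_element L x}" using compact_element_radicalD by (auto simp: S_def)
    have "basic_open L ` S = \<U>"
    proof
      show "\<U> \<subseteq> basic_open L ` S"
      proof
        fix U assume U: "U \<in> \<U>"
        then obtain c where "compact_element (radical_lattice L) c" "U = basic_open L c"
          using \<U>(1) compact_openin_zariski_iff[of U] by auto
        then show "U \<in> basic_open L ` S" using U by (auto simp: S_def)
      qed
    qed (auto simp: S_def)
    \<comment> \<open>The join of \<open>S\<close> and \<open>r\<close> define the same open set, so
      they coincide by injectivity of \<open>basic_open\<close> on radical elements.\<close>
    then have "basic_open L (\<Squnion>\<^bsub>radical_lattice L\<^esub>S) = basic_open L r"
      using basic_open_radical_Sup[OF S] \<U>(2) by simp
    then have "r = \<Squnion>\<^bsub>radical_lattice L\<^esub>S"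
      using basic_open_inject[OF r] R.sup_closed[of S] S by (simp add: radical_lattice_simps)
    then show "\<exists>S\<subseteq>{c. compact_element (radical_lattice L) c}. r = \<Squnion>\<^bsub>radical_lattice L\<^esub>S"
      by (intro exI[of _ S]) (auto simp: S_def)
  qed
  then show ?thesis
    unfolding algebraic_lattice_def openin_zariski_iff_radical
    by (auto simp: radical_lattice_simps)
qed

text \<open>Compact open sets are precisely the images of compact elements, and the image of a meet
  is the intersection of the images, so quantifying over pairs on either side amounts to the
  same.\<close>

lemma compact_radical_meet_iff:
  "(\<forall>x y. compact_element (radical_lattice L) x \<longrightarrow> compact_element (radical_lattice L) y \<longrightarrow>
      compact_element (radical_lattice L) (x \<sqinter>\<^bsub>radical_lattice L\<^esub> y)) \<longleftrightarrow>
   (\<forall>U W. compact_openin (zariski_topology L) U \<longrightarrow> compact_openin (zariski_topology L) W \<longrightarrow>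
      compact_openin (zariski_topology L) (U \<inter> W))"
proof -
  have "compact_element (radical_lattice L) (x \<sqinter>\<^bsub>radical_lattice L\<^esub> y) \<longleftrightarrow>
      compact_openin (zariski_topology L) (basic_open L x \<inter> basic_open L y)"
    if "compact_element (radical_lattice L) x" "compact_element (radical_lattice L) y" for x y
    using that[THEN compact_element_radicalD]
    by (simp add: compact_element_radical_iff radical_meet(1) basic_open_radical_meet)
  moreover have "(\<forall>U W. compact_openin (zariski_topology L) U \<longrightarrow>
        compact_openin (zariski_topology L) W \<longrightarrow> compact_openin (zariski_topology L) (U \<inter> W)) \<longleftrightarrow>
      (\<forall>x y. compact_element (radical_lattice L) x \<longrightarrow> compact_element (radical_lattice L) y \<longrightarrow>
        compact_openin (zariski_topology L) (basic_open L x \<inter> basic_open L y))"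
    using compact_openin_zariski_iff by metis
  ultimately show ?thesis by blast
qed

end

section \<open>Finite intersections and the conclusion\<close>

lemma compact_openin_finite_Inter_iff:
  assumes "compact_space X"
  shows "(\<forall>\<F>. finite \<F> \<longrightarrow> (\<forall>U\<in>\<F>. compact_openin X U) \<longrightarrow> compact_openin X (topspace X \<inter> \<Inter>\<F>)) \<longleftrightarrow>
         (\<forall>U W. compact_openin X U \<longrightarrow> compact_openin X W \<longrightarrow> compact_openin X (U \<inter> W))"
    (is "?fin \<longleftrightarrow> ?bin")
proof (intro iffI allI impI)
  fix U W assume fin: ?fin and UW: "compact_openin X U" "compact_openin X W"
  have "compact_openin X (topspace X \<inter> \<Inter>{U, W})"
    using UW by (intro fin[rule_format]) auto
  moreover have "topspace X \<inter> \<Inter>{U, W} = U \<inter> W"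
    using openin_subset[of X U] UW(1) by (auto simp: compact_openin_def)
  ultimately show "compact_openin X (U \<inter> W)" by simp
next
  fix \<F> assume bin: ?bin and "finite \<F>" "\<forall>U\<in>\<F>. compact_openin X U"
  from this(2,3) show "compact_openin X (topspace X \<inter> \<Inter>\<F>)"
  proof (induction rule: finite_induct)
    \<comment> \<open>The empty intersection is the whole space, so this case is the compactness of
      \<open>X\<close>.\<close>
    case empty
    then show ?case using assms by (simp add: compact_openin_def compact_space_def)
  next
    case (insert U \<F>)
    then have "compact_openin X (U \<inter> (topspace X \<inter> \<Inter>\<F>))" using bin by simp
    then show ?case by (simp add: Int_left_commute)
  qed
qed

theorem theorem3p6:
  fixes L :: "('a, 'b) multiplicative_lattice_scheme"
  assumes "complete_multiplicative_lattice L"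
  shows "spectral_space (zariski_topology L) \<longleftrightarrow>
           compact_lattice (radical_lattice L) \<and>
           algebraic_lattice (radical_lattice L) \<and>
           (\<forall>x y. compact_element (radical_lattice L) x \<longrightarrow>
                  compact_element (radical_lattice L) y \<longrightarrow>
                  compact_element (radical_lattice L) (x \<sqinter>\<^bsub>radical_lattice L\<^esub> y))"
proof -
  interpret complete_multiplicative_lattice L by (rule assms)
  \<comment> \<open>After the translation, sobriety holds outright, and the finite and binary forms
    of the intersection condition are exchanged under compactness, which belongs to both
    sides.\<close>
  show ?thesis
    unfolding spectral_space_def compact_radical_lattice_iff algebraic_radical_lattice_iff
      compact_radical_meet_iff
    using sober_zariski_topology compact_openin_finite_Inter_iff[of "zariski_topology L"] by blast
qed

end
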